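(* Let $n\ge 4$. If $G$ is a $K_{2,3}$-saturated bipartite graph with vertex classes $U$ and $U'$ each of size $n$, then $G$ has at least $3n-2$ edges.
   Context: $G$ is $K_{2,3}$-saturated if it contains no copy of $K_{2,3}$, and adding any missing edge $uu'$ with $u\in U$ and $u'\in U'$ creates a new copy of $K_{2,3}$ (one containing $uu'$). This copy may have $2$ vertices in $U$ and $3$ in $U'$, or $3$ vertices in $U$ and $2$ in $U'$. *)

theory Defs
  imports Main
begin

text \<open>A simple graph is given by its edge set, edges being two-element sets of vertices.\<close>

definition bipartite_graph :: "'a set \<Rightarrow> 'a set \<Rightarrow> 'a set set \<Rightarrow> bool" where
  "bipartite_graph U U' E \<longleftrightarrow>
     finite U \<and> finite U' \<and> U \<inter> U' = {} \<and> E \<subseteq> {{u, u'} | u u'. u \<in> U \<and> u' \<in> U'}"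

text \<open>The edge sets of all copies of \<open>K\<^sub>s\<^sub>,\<^sub>t\<close> on vertices of the type. Since \<open>s, t > 0\<close> in
  the use below, every vertex of a copy lies on an edge, so the graph with edge set \<open>E\<close>
  contains a copy iff \<open>F \<subseteq> E\<close> for some \<open>F\<close> in this set. Nothing ties the part of size
  \<open>s\<close> to a particular class of a bipartite host graph, so both orientations count.\<close>

definition complete_bipartite_copies :: "nat \<Rightarrow> nat \<Rightarrow> 'a set set set" where
  "complete_bipartite_copies s t =
     {{{a, b} | a b. a \<in> A \<and> b \<in> B} | A B.
        finite A \<and> finite B \<and> card A = s \<and> card B = t \<and> A \<inter> B = {}}"

text \<open>Only non-edges between the two classes have to create a copy when added.\<close>

definition K23_saturated :: "'a set \<Rightarrow> 'a set \<Rightarrow> 'a set set \<Rightarrow> bool" where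
  "K23_saturated U U' E \<longleftrightarrow>
     (\<forall>F \<in> complete_bipartite_copies 2 3. \<not> F \<subseteq> E) \<and>
     (\<forall>u \<in> U. \<forall>u' \<in> U'. {u, u'} \<notin> E \<longrightarrow>
        (\<exists>F \<in> complete_bipartite_copies 2 3. {u, u'} \<in> F \<and> F \<subseteq> insert {u, u'} E))"

end

theory Submission
  imports Defs
begin

text \<open>Double counting around a vertex \<open>v\<close> such that every other vertex of its class has two neighbours
  in \<open>N v\<close> gives \<open>3n - 2\<close> edges, and a vertex of degree at most 1 forces its neighbour to be
  such a \<open>v\<close>. So all degrees may be assumed to be at least 2, and some \<open>u\<close> has exactly two
  neighbours \<open>a\<close>, \<open>b\<close>. Saturation at \<open>u\<close> bounds the degrees in the opposite class from below,
  and summing them yields the bound, except possibly if \<open>a\<close> and \<open>b\<close> have a second common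
  neighbour \<open>v\<close> and there is a vertex \<open>r\<close> outside \<open>N a \<union> N b\<close>, each of whose neighbours meets
  \<open>N a \<union> N b\<close> only in \<open>v\<close>, with some \<open>x \<in> N r\<close> of degree 2. Then \<open>N x = {v, r}\<close>, and
  saturation at \<open>x\<close> makes a variant of the count around \<open>v\<close> work.\<close>

section \<open>Neighbourhoods and the symmetric setting\<close>

definition nbrs :: "'a set set \<Rightarrow> 'a \<Rightarrow> 'a set" where
  "nbrs E x = {y. {x, y} \<in> E}"

lemma nbrs_sym: "y \<in> nbrs E x \<longleftrightarrow> x \<in> nbrs E y"
  by (simp add: nbrs_def insert_commute)

lemma two_le_card: "2 \<le> card S" if "finite S" "x \<in> S" "y \<in> S" "x \<noteq> y"
  using card_mono[of S "{x, y}"] that by simp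

locale K23_saturated_bipartite =
  fixes U V :: "'a set" and E :: "'a set set"
  assumes bip: "bipartite_graph U V E"
    and sat: "K23_saturated U V E"
    and card_eq: "card U = card V"
begin

abbreviation N :: "'a \<Rightarrow> 'a set" where "N \<equiv> nbrs E"

lemma finite_U: "finite U" and finite_V: "finite V" and disjoint_UV: "U \<inter> V = {}"
  using bip by (auto simp: bipartite_graph_def)

lemma nbrs_subset: "u \<in> U \<Longrightarrow> N u \<subseteq> V"
  using bip unfolding bipartite_graph_def nbrs_def by (force simp: doubleton_eq_iff)

lemma not_nbr_self: "x \<notin> N x"
  using bip unfolding bipartite_graph_def nbrs_def by (force simp: doubleton_eq_iff)

text \<open>All assumptions are symmetric in the two classes. Interpreting the locale through this
  fact makes every result about \<open>U\<close> available for \<open>V\<close>, under the prefix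
  \<open>F\<close>.\<close>

lemma flip: "K23_saturated_bipartite V U E"
proof
  have "E \<subseteq> {{u, u'} | u u'. u \<in> V \<and> u' \<in> U}"
  proof
    fix e assume "e \<in> E"
    then obtain u u' where u: "e = {u, u'}" "u \<in> U" "u' \<in> V"
      using bip unfolding bipartite_graph_def by blast
    then have "e = {u', u}" by auto
    then show "e \<in> {{u, u'} | u u'. u \<in> V \<and> u' \<in> U}" using u by blast
  qed
  then show "bipartite_graph V U E"
    using bip by (simp add: bipartite_graph_def Int_commute)
  show "K23_saturated V U E"
    unfolding K23_saturated_def
  proof (intro conjI ballI impI)
    fix y x assume "y \<in> V" "x \<in> U" "{y, x} \<notin> E"
    moreover have "{y, x} = {x, y}" by auto
    ultimately show "\<exists>F\<in>complete_bipartite_copies 2 3. {y, x} \<in> F \<and> F \<subseteq> insert {y, x} E"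
      using sat unfolding K23_saturated_def by simp
  qed (use sat in \<open>simp add: K23_saturated_def\<close>)
  show "card V = card U" using card_eq by simp
qed

lemma finite_nbrs: "finite (N x)"
proof -
  have "N x \<subseteq> U \<union> V"
    using bip unfolding bipartite_graph_def nbrs_def by (force simp: doubleton_eq_iff)
  then show ?thesis using finite_U finite_V finite_subset by blast
qed

section \<open>Edge counts by degrees\<close>

lemma card_edges: "card E = (\<Sum>u\<in>U. card (N u))"
proof -
  have inj: "inj_on (\<lambda>(u, y). {u, y}) (SIGMA u:U. N u)"
    using nbrs_subset disjoint_UV by (fastforce simp: inj_on_def doubleton_eq_iff)
  have "E = (\<lambda>(u, y). {u, y}) ` (SIGMA u:U. N u)"
    using bip unfolding bipartite_graph_def nbrs_def by fastforce
  then have "card E = card (SIGMA u:U. N u)"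
    using card_image[OF inj] by simp
  then show ?thesis using finite_U finite_nbrs by simp
qed

lemma sum_card_nbrs_Int:
  assumes "finite A" "finite B"
  shows "(\<Sum>u\<in>A. card (N u \<inter> B)) = (\<Sum>y\<in>B. card (N y \<inter> A))"
proof -
  have *: "card (N x \<inter> C) = (\<Sum>y\<in>C. if y \<in> N x then 1 else 0)" if "finite C" for x C
    using that by (simp add: sum.If_cases Int_commute Collect_mem_eq)
  show ?thesis
    unfolding *[OF assms(1)] *[OF assms(2)]
    by (subst sum.swap) (simp add: nbrs_sym)
qed

section \<open>Local consequences of saturation\<close>

lemma card_common_nbrs: "card (N x \<inter> N y) \<le> 2" if "x \<noteq> y"
proof (rule ccontr)
  assume "\<not> ?thesis"
  then have "3 \<le> card (N x \<inter> N y)" by simp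
  then obtain B where B: "B \<subseteq> N x \<inter> N y" "card B = 3"
    by (rule obtain_subset_with_card_n)
  have "{x, y} \<inter> B = {}" using B not_nbr_self by auto
  then have "{{a, b} | a b. a \<in> {x, y} \<and> b \<in> B} \<in> complete_bipartite_copies 2 3"
    unfolding complete_bipartite_copies_def
    using B(2) that card_ge_0_finite[of B] by (intro CollectI exI[of _ "{x, y}"] exI[of _ B]) simp
  moreover have "{{a, b} | a b. a \<in> {x, y} \<and> b \<in> B} \<subseteq> E"
    using B by (auto simp: nbrs_def)
  moreover have "\<forall>F\<in>complete_bipartite_copies 2 3. \<not> F \<subseteq> E"
    using sat unfolding K23_saturated_def by (rule conjunct1)
  ultimately show False by blast
qed

text \<open>The two cases are the two orientations of the copy created by the edge from
  \<open>u\<close> to \<open>y\<close>. In \<open>two\<close> its parts are \<open>{u, v}\<close>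
  and \<open>{y, z, t}\<close>; in \<open>three\<close> they are \<open>{y, z}\<close> and
  \<open>{u, v, w}\<close>. The conclusions list old edges of the copy.\<close>

lemma new_copy:
  assumes "u \<in> U" "y \<in> V" "y \<notin> N u"
  obtains (two) v z t where "v \<noteq> u" "z \<noteq> t" "z \<noteq> y" "t \<noteq> y"
      "z \<in> N u" "t \<in> N u" "y \<in> N v" "z \<in> N v" "t \<in> N v"
  | (three) z v w where "v \<noteq> w" "v \<noteq> u" "w \<noteq> u"
      "z \<in> N u" "v \<in> N y" "w \<in> N y" "v \<in> N z" "w \<in> N z"
proof -
  have "{u, y} \<notin> E" using assms by (simp add: nbrs_def)
  then obtain F where "F \<in> complete_bipartite_copies 2 3" "{u, y} \<in> F" "F \<subseteq> insert {u, y} E"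
    using sat assms unfolding K23_saturated_def by metis
  then obtain A B where AB: "card A = 2" "card B = 3" "A \<inter> B = {}"
    and in_F: "{u, y} \<in> {{a, b} | a b. a \<in> A \<and> b \<in> B}"
    and F: "{{a, b} | a b. a \<in> A \<and> b \<in> B} \<subseteq> insert {u, y} E"
    unfolding complete_bipartite_copies_def mem_Collect_eq by (elim exE conjE) simp
  have edge: "b \<in> N a" if "a \<in> A" "b \<in> B" "{a, b} \<noteq> {u, y}" for a b
    using F that unfolding nbrs_def by blast
  from in_F consider "u \<in> A" "y \<in> B" | "y \<in> A" "u \<in> B"
    by (auto simp: doubleton_eq_iff)
  then show thesis
  proof cases
    case 1
    obtain v where A: "A = {u, v}" "v \<noteq> u"
      using AB(1) 1 unfolding card_2_iff by fastforce
    have "card (B - {y}) = 2" using AB(2) 1 by simp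
    then obtain z t where B: "B - {y} = {z, t}" "z \<noteq> t" unfolding card_2_iff by blast
    then have zt: "z \<in> B" "t \<in> B" "z \<noteq> y" "t \<noteq> y" by auto
    have "v \<in> A" "v \<noteq> y" "u \<noteq> y" using A 1 AB(3) by auto
    show thesis
    proof (rule two[of v z t])
      show "z \<in> N u" "t \<in> N u"
        using 1 zt by (simp_all add: edge doubleton_eq_iff)
      show "y \<in> N v" "z \<in> N v" "t \<in> N v"
        using 1 zt \<open>v \<in> A\<close> \<open>v \<noteq> y\<close> A(2) by (simp_all add: edge doubleton_eq_iff)
    qed (use A(2) B(2) zt in auto)
  next
    case 2
    obtain z where A: "A = {y, z}" "z \<noteq> y"
      using AB(1) 2 unfolding card_2_iff by fastforce
    have "card (B - {u}) = 2" using AB(2) 2 by simp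
    then obtain v w where B: "B - {u} = {v, w}" "v \<noteq> w" unfolding card_2_iff by blast
    then have vw: "v \<in> B" "w \<in> B" "v \<noteq> u" "w \<noteq> u" by auto
    have "z \<in> A" "z \<noteq> u" using A 2 AB(3) by auto
    show thesis
    proof (rule three[of v w z])
      have "u \<in> N z"
        using 2 \<open>z \<in> A\<close> \<open>z \<noteq> u\<close> A(2) by (simp add: edge doubleton_eq_iff)
      then show "z \<in> N u" by (rule nbrs_sym[THEN iffD1])
      show "v \<in> N y" "w \<in> N y"
        using 2 vw by (simp_all add: edge doubleton_eq_iff)
      show "v \<in> N z" "w \<in> N z"
        using 2 vw \<open>z \<in> A\<close> \<open>z \<noteq> u\<close> A(2) by (simp_all add: edge doubleton_eq_iff)
    qed (use B(2) vw in auto)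
  qed
qed

lemma nbrs_nonempty: "N u \<noteq> {}" if "u \<in> U"
proof
  assume empty: "N u = {}"
  have "V \<noteq> {}" using that card_eq finite_U by (metis card_eq_0_iff empty_iff)
  then obtain y where "y \<in> V" by blast
  have "y \<notin> N u" using empty by simp
  from \<open>u \<in> U\<close> \<open>y \<in> V\<close> this show False by (cases rule: new_copy) (simp_all add: empty)
qed

text \<open>A copy with two vertices in \<open>U\<close> uses two neighbours of \<open>u\<close>
  besides \<open>y\<close>, and these must be \<open>a\<close> and \<open>b\<close>; its other
  vertex \<open>v\<close> is then joined to \<open>a\<close>, \<open>b\<close> and \<open>y\<close>.
  In the other orientation \<open>y\<close> is paired with \<open>a\<close> or \<open>b\<close> and
  shares two further neighbours with it.\<close>

lemma new_copy_degree_2: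
  assumes "u \<in> U" "N u = {a, b}" "y \<in> V" "y \<noteq> a" "y \<noteq> b"
  shows "(\<exists>v. v \<noteq> u \<and> v \<in> N a \<and> v \<in> N b \<and> v \<in> N y)
    \<or> 2 \<le> card (N y \<inter> N a) \<or> 2 \<le> card (N y \<inter> N b)"
proof -
  have "y \<notin> N u" using assms by auto
  from assms(1,3) this show ?thesis
  proof (cases rule: new_copy)
    case (two v z t)
    then have "{z, t} = {a, b}" using assms(2) by auto
    then have "a \<in> N v" "b \<in> N v" using two by auto
    then show ?thesis using two nbrs_sym by metis
  next
    case (three z v w)
    then have "2 \<le> card (N y \<inter> N z)"
      by (intro two_le_card[of _ v w]) (auto simp: finite_nbrs)
    then show ?thesis using three assms(2) by auto
  qed
qed

section \<open>Counting around a centre, and vertices of low degree\<close>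

text \<open>Write S for \<open>U - R - {v}\<close>. Summing degrees over \<open>U\<close>, the
  centre gives \<open>card (N v)\<close>, \<open>R\<close> gives at least 2 per vertex, and S gives
  at least 2 per vertex inside \<open>N v\<close>. By \<open>far\<close>, S also sends at least one
  edge to each of the \<open>card V - card (N v)\<close> vertices outside \<open>N v\<close>. With n
  = \<open>card U\<close> this is 2(n - 1) + n in total.\<close>

lemma card_edges_star:
  assumes v: "v \<in> U" and R: "R \<subseteq> U - {v}"
    and deg_R: "\<And>w. w \<in> R \<Longrightarrow> 2 \<le> card (N w)"
    and common: "\<And>w. w \<in> U - R - {v} \<Longrightarrow> 2 \<le> card (N w \<inter> N v)"
    and far: "\<And>y. y \<in> V - N v \<Longrightarrow> N y \<inter> (U - R) \<noteq> {}"
  shows "3 * card U - 2 \<le> card E"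
proof -
  let ?S = "U - R - {v}"
  have fin: "finite R" "finite ?S" using R finite_U finite_subset by auto
  have split: "card (N w) = card (N w \<inter> N v) + card (N w \<inter> (V - N v))" if "w \<in> U" for w
    using nbrs_subset[OF that] finite_nbrs
    by (subst card_Un_disjoint[symmetric]) (auto intro!: arg_cong[where f = card])
  have "(\<Sum>w\<in>?S. card (N w \<inter> (V - N v))) = (\<Sum>y\<in>V - N v. card (N y \<inter> ?S))"
    using fin finite_V by (intro sum_card_nbrs_Int) auto
  also have "\<dots> \<ge> (\<Sum>y\<in>V - N v. 1)"
  proof (rule sum_mono)
    fix y assume y: "y \<in> V - N v"
    then have "v \<notin> N y" using nbrs_sym[of v E y] by simp
    then have "N y \<inter> ?S \<noteq> {}" using far[OF y] by blast
    then show "1 \<le> card (N y \<inter> ?S)"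
      using finite_nbrs by (simp add: Suc_leI card_gt_0_iff)
  qed
  finally have "(\<Sum>w\<in>?S. card (N w \<inter> (V - N v))) \<ge> card V - card (N v)"
    using nbrs_subset[OF v] finite_nbrs by (simp add: card_Diff_subset)
  moreover have "(\<Sum>w\<in>?S. card (N w \<inter> N v)) \<ge> 2 * card ?S"
    using sum_mono[of ?S "\<lambda>_. 2" "\<lambda>w. card (N w \<inter> N v)"] common by simp
  moreover have "(\<Sum>w\<in>R. card (N w)) \<ge> 2 * card R"
    using sum_mono[of R "\<lambda>_. 2" "\<lambda>w. card (N w)"] deg_R by simp
  moreover have "(\<Sum>w\<in>?S. card (N w))
      = (\<Sum>w\<in>?S. card (N w \<inter> N v)) + (\<Sum>w\<in>?S. card (N w \<inter> (V - N v)))"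
    unfolding sum.distrib[symmetric] by (rule sum.cong) (auto simp: split)
  moreover have "(\<Sum>w\<in>U. card (N w))
      = card (N v) + (\<Sum>w\<in>R. card (N w)) + (\<Sum>w\<in>?S. card (N w))"
  proof -
    have "U = insert v (R \<union> ?S)" using v R by blast
    moreover have "v \<notin> R \<union> ?S" "R \<inter> ?S = {}" using R by auto
    ultimately show ?thesis
      using fin sum.insert[of "R \<union> ?S" v "\<lambda>w. card (N w)"]
        sum.union_disjoint[of R ?S "\<lambda>w. card (N w)"] by simp
  qed
  moreover have "card U = 1 + card R + card ?S"
  proof -
    have "U - {v} = R \<union> ?S" "R \<inter> ?S = {}" using R by auto
    then have "card (U - {v}) = card R + card ?S" using fin card_Un_disjoint[of R ?S] by simp
    moreover have "card U = Suc (card (U - {v}))" using v finite_U by (intro card.remove)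
    ultimately show ?thesis by linarith
  qed
  moreover have "card (N v) \<le> card V" using nbrs_subset[OF v] finite_V by (rule card_mono[rotated])
  ultimately show ?thesis using card_edges card_eq by linarith
qed

text \<open>A single neighbour \<open>a\<close> rules out the orientation that uses two old
  neighbours of \<open>u\<close>. So each other vertex of \<open>V\<close> shares two neighbours
  with \<open>a\<close>, and \<open>a\<close> is a centre for the star count in the flipped graph,
  with nothing exempted.\<close>

lemma card_edges_degree_1:
  assumes u: "u \<in> U" "card (N u) < 2"
  shows "3 * card U - 2 \<le> card E"
proof -
  interpret F: K23_saturated_bipartite V U E by (rule flip)
  have "card (N u) = 1" using u nbrs_nonempty[of u] finite_nbrs[of u]
    by (metis One_nat_def card_0_eq less_2_cases)
  then obtain a where a: "N u = {a}" using card_1_singletonE by blast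
  then have "a \<in> V" using nbrs_subset u by blast
  moreover have "2 \<le> card (N y \<inter> N a)" if y: "y \<in> V - {a}" for y
  proof -
    have "y \<notin> N u" using y a by simp
    have "y \<in> V" using y by simp
    from u(1) this \<open>y \<notin> N u\<close> show ?thesis
    proof (cases rule: new_copy)
      case (three z v w)
      then show ?thesis
        using a by (intro two_le_card[of _ v w]) (auto simp: finite_nbrs)
    qed (use a in auto)
  qed
  ultimately have "3 * card V - 2 \<le> card E"
  proof (intro F.card_edges_star[of a "{}"])
    show "N w \<inter> (V - {}) \<noteq> {}" if "w \<in> U - N a" for w
      using that nbrs_nonempty[of w] nbrs_subset[of w] by blast
  qed auto
  then show ?thesis using card_eq by simp
qed

section \<open>A vertex of degree 2 whose neighbours share nothing else\<close>

lemma card_edges_pair: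
  assumes "a \<in> V" "b \<in> V" "a \<noteq> b"
  shows "card E = card (N a \<union> N b) + card (N a \<inter> N b) + (\<Sum>y\<in>V - {a, b}. card (N y))"
proof -
  interpret F: K23_saturated_bipartite V U E by (rule flip)
  have "card E = (\<Sum>y\<in>V. card (N y))" by (rule F.card_edges)
  also have "\<dots> = card (N a) + card (N b) + (\<Sum>y\<in>V - {a, b}. card (N y))"
    using sum.subset_diff[of "{a, b}" V "\<lambda>y. card (N y)"] assms finite_V by simp
  finally show ?thesis using card_Un_Int[of "N a" "N b"] finite_nbrs by simp
qed

lemma card_edges_degree_2_unique:
  assumes deg: "\<And>w. w \<in> U \<union> V \<Longrightarrow> 2 \<le> card (N w)"
    and u: "u \<in> U" and ab: "N u = {a, b}" "a \<noteq> b"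
    and common: "N a \<inter> N b = {u}"
  shows "3 * card U - 2 \<le> card E"
proof -
  interpret F: K23_saturated_bipartite V U E by (rule flip)
  let ?W = "N a \<union> N b" and ?Y = "V - {a, b}"
  have V: "a \<in> V" "b \<in> V" using nbrs_subset[OF u] ab by auto
  have W: "?W \<subseteq> U" using F.nbrs_subset V by blast
  have card_Y: "card ?Y = card U - 2" using V ab card_eq finite_V by (simp add: card_Diff_subset)
  have card_U: "2 \<le> card U" using V ab card_eq finite_V two_le_card by metis
  have two_in: "2 \<le> card (N y \<inter> N a) \<or> 2 \<le> card (N y \<inter> N b)" if "y \<in> ?Y" for y
    using new_copy_degree_2[OF u ab(1), of y] that common by blast
  have in_W: "2 \<le> card (N y \<inter> ?W)" if "y \<in> ?Y" for y
    using two_in[OF that] card_mono[of "N y \<inter> ?W" "N y \<inter> N a"]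
      card_mono[of "N y \<inter> ?W" "N y \<inter> N b"] finite_nbrs by fastforce
  have E: "card E = card ?W + 1 + (\<Sum>y\<in>?Y. card (N y))"
    using card_edges_pair[OF V ab(2)] common by simp
  show ?thesis
  proof (cases "?W = U")
    \<comment> \<open>Every edge at a vertex of \<open>?R\<close> ends in \<open>?Y\<close> and
      comes on top of the two edges that each vertex of \<open>?Y\<close> sends into
      \<open>?W\<close>. With n = \<open>card U\<close> the total is at least \<open>card ?W\<close>
      + 1 + 2(n - 2) + 2 \<open>card ?R\<close>, which is 3n - 3 + \<open>card ?R\<close>, and
      \<open>?R\<close> is nonempty.\<close>
    case False
    let ?R = "U - ?W"
    have split: "card (N y) = card (N y \<inter> ?W) + card (N y \<inter> ?R)" if "y \<in> V" for y
      using F.nbrs_subset[OF that] finite_nbrs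
      by (subst card_Un_disjoint[symmetric]) (auto intro!: arg_cong[where f = card])
    have "(\<Sum>y\<in>?Y. card (N y \<inter> ?R)) = (\<Sum>r\<in>?R. card (N r \<inter> ?Y))"
      using finite_U finite_V by (intro sum_card_nbrs_Int) auto
    also have "\<dots> = (\<Sum>r\<in>?R. card (N r))"
    proof (rule sum.cong[OF refl])
      fix r assume "r \<in> ?R"
      then have "N r \<subseteq> ?Y"
        using nbrs_subset[of r] nbrs_sym[of r E a] nbrs_sym[of r E b] by auto
      then show "card (N r \<inter> ?Y) = card (N r)" by (simp add: inf.absorb1)
    qed
    also have "\<dots> \<ge> 2 * card ?R"
      using sum_mono[of ?R "\<lambda>_. 2" "\<lambda>r. card (N r)"] deg by simp
    finally have "(\<Sum>y\<in>?Y. card (N y \<inter> ?R)) \<ge> 2 * card ?R" .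
    moreover have "(\<Sum>y\<in>?Y. card (N y \<inter> ?W)) \<ge> 2 * card ?Y"
      using sum_mono[of ?Y "\<lambda>_. 2" "\<lambda>y. card (N y \<inter> ?W)"] in_W by simp
    moreover have "(\<Sum>y\<in>?Y. card (N y)) = (\<Sum>y\<in>?Y. card (N y \<inter> ?W)) + (\<Sum>y\<in>?Y. card (N y \<inter> ?R))"
      unfolding sum.distrib[symmetric] by (rule sum.cong) (auto simp: split)
    moreover have "card ?R = card U - card ?W" using W finite_nbrs by (simp add: card_Diff_subset)
    moreover have "card ?W < card U" using False W finite_U psubset_card_mono by blast
    ultimately show ?thesis using E card_Y card_U by linarith
  next
    \<comment> \<open>Degrees of at least 2 on \<open>?Y\<close> now give only 3n - 3, so one extra
      edge has to be found: either some degree on \<open>?Y\<close> exceeds 2, or saturation is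
      violated.\<close>
    case True
    show ?thesis
    proof (cases "\<exists>x\<in>?Y. 2 < card (N x)")
      case True
      then obtain x where "x \<in> ?Y" "2 < card (N x)" by blast
      then have "(\<Sum>y\<in>?Y. card (N y)) > (\<Sum>y\<in>?Y. 2)"
        using deg finite_V by (intro sum_strict_mono_ex1) auto
      then show ?thesis using E card_Y card_U \<open>?W = U\<close> by simp
    next
      case False
      have nbr_Y: "N y \<subseteq> N a \<or> N y \<subseteq> N b" "card (N y) = 2" if "y \<in> ?Y" for y
      proof -
        have "\<not> 2 < card (N y)" using False that by blast
        then show 2: "card (N y) = 2" using deg[of y] that by simp
        have "N y \<inter> N c = N y" if "2 \<le> card (N y \<inter> N c)" for c
          using that 2 finite_nbrs by (intro card_seteq) auto
        then show "N y \<subseteq> N a \<or> N y \<subseteq> N b" using two_in[OF that] by blast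
      qed
      have "u \<in> N a" using ab nbrs_sym[of u E a] by simp
      moreover have "N a \<noteq> {u}" using deg[of a] V by auto
      ultimately obtain p where p: "p \<in> N a" "p \<noteq> u" by blast
      then have pb: "p \<notin> N b" using common by blast
      have "p \<in> U" using p W by blast
      have "b \<notin> N p" using pb nbrs_sym[of p E b] by simp
      \<comment> \<open>The missing edge from \<open>p\<close> to \<open>b\<close> cannot create a
        copy. One orientation needs a vertex of \<open>?Y\<close> adjacent both to \<open>p\<close>,
        outside \<open>N b\<close>, and to some \<open>v\<close> outside \<open>N a\<close>, against
        \<open>nbr_Y\<close>. The other needs either three neighbours of a vertex of
        \<open>?Y\<close> or two common neighbours of \<open>a\<close> and \<open>b\<close>.\<close>
      have False using \<open>p \<in> U\<close> V(2) \<open>b \<notin> N p\<close>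
      proof (cases rule: new_copy)
        case (two v z t)
        have vb: "v \<in> N b" using two nbrs_sym[of v E b] by simp
        have "v \<noteq> u" using two ab by auto
        then have va: "v \<notin> N a" using common vb by blast
        have "z \<noteq> a" using two va nbrs_sym[of v E a] by auto
        then have "z \<in> ?Y" using two nbrs_subset[OF \<open>p \<in> U\<close>] by auto
        moreover have "p \<in> N z" "v \<in> N z" using two nbrs_sym[of p E z] nbrs_sym[of v E z] by simp_all
        ultimately show False using nbr_Y(1)[of z] pb va by blast
      next
        case (three z v w)
        have "z \<noteq> a"
        proof
          assume "z = a"
          then have "v \<in> N a \<inter> N b" "w \<in> N a \<inter> N b" using three by auto
          then show False using three(1) by (simp add: common)
        qed
        then have "z \<in> ?Y" using three nbrs_subset[OF \<open>p \<in> U\<close>] \<open>b \<notin> N p\<close> by auto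
        then have "card (N z) = 2" by (rule nbr_Y)
        moreover have "p \<in> N z" using three nbrs_sym[of p E z] by simp
        then have "card {p, v, w} \<le> card (N z)"
          using three finite_nbrs by (intro card_mono) auto
        ultimately show False using three by simp
      qed
      then show ?thesis ..
    qed
  qed
qed

section \<open>A vertex of degree 2 whose neighbours share a second vertex\<close>

text \<open>This is the configuration in which discharging fails, with \<open>W\<close> standing for
  \<open>N a \<union> N b\<close>. The star count around \<open>v\<close> works once
  \<open>U - W\<close> is exempted, where degree at least 2 suffices.\<close>

lemma card_edges_bad:
  assumes deg: "\<And>w. w \<in> U \<union> V \<Longrightarrow> 2 \<le> card (N w)"
    and v: "v \<in> W" and W: "W \<subseteq> U" and r: "r \<in> U - W"
    and nbr_r: "\<And>y. y \<in> N r \<Longrightarrow> N y \<inter> W = {v}"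
    and x: "x \<in> N r" "card (N x) = 2"
    and far: "\<And>y. y \<in> V - N v \<Longrightarrow> N y \<inter> W \<noteq> {}"
  shows "3 * card U - 2 \<le> card E"
proof -
  interpret F: K23_saturated_bipartite V U E by (rule flip)
  have vU: "v \<in> U" and rv: "r \<noteq> v" using v W r by auto
  have r_sub: "N r \<subseteq> N v"
  proof
    fix y assume "y \<in> N r"
    then have "v \<in> N y" using nbr_r by blast
    then show "y \<in> N v" using nbrs_sym[of v E y] by simp
  qed
  have "card (N r) = 2"
    using card_common_nbrs[OF rv] r_sub deg[of r] r by (simp add: inf.absorb1)
  then have "card (N r - {x}) = 1" using x(1) finite_nbrs by simp
  then obtain y where "N r - {x} = {y}" by (rule card_1_singletonE)
  then have y: "N r = {x, y}" using x(1) by blast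
  have xV: "x \<in> V" using x r nbrs_subset by blast
  have "v \<in> N x" "r \<in> N x" using r_sub x nbrs_sym[of v E x] nbrs_sym[of r E x] by auto
  then have Nx: "N x = {v, r}"
    using x(2) rv finite_nbrs by (intro card_seteq[symmetric]) auto
  \<comment> \<open>Saturation at \<open>x\<close>, whose neighbours are \<open>v\<close> and
    \<open>r\<close>, leaves three options. Two common neighbours of \<open>w\<close> and
    \<open>r\<close> are impossible, since only \<open>y\<close> can be one. A common neighbour of
    \<open>v\<close>, \<open>r\<close> and \<open>w\<close> meets \<open>W\<close> only in
    \<open>v\<close>, so it puts \<open>w\<close> outside \<open>W\<close>. What remains is the
    desired overlap with \<open>N v\<close>.\<close>
  have close: "2 \<le> card (N w \<inter> N v) \<or> w \<in> U - W" if w: "w \<in> U" "w \<noteq> v" for w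
  proof (cases "w = r")
    case False
    have small: "\<not> 2 \<le> card (N w \<inter> N r)"
    proof -
      have "x \<notin> N w" using Nx False w nbrs_sym[of x E w] by simp
      then have "N w \<inter> N r \<subseteq> {y}" using y by auto
      then show ?thesis using card_mono[of "{y}" "N w \<inter> N r"] by simp
    qed
    from F.new_copy_degree_2[OF xV Nx w(1,2) False] show ?thesis
    proof (elim disjE exE)
      fix z assume "z \<noteq> x \<and> z \<in> N v \<and> z \<in> N r \<and> z \<in> N w"
      then have "w \<in> N z" "z \<in> N r" using nbrs_sym[of w E z] by simp_all
      then have "w \<notin> W" using nbr_r[of z] w by blast
      then show ?thesis using w by blast
    qed (use small in auto)
  qed (use r in auto)
  show ?thesis
  proof (rule card_edges_star[OF vU, of "U - W"])
    show "N z \<inter> (U - (U - W)) \<noteq> {}" if "z \<in> V - N v" for z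
      using far[OF that] W by blast
  qed (use v deg close in auto)
qed

lemma card_edges_degree_2_shared:
  assumes deg: "\<And>w. w \<in> U \<union> V \<Longrightarrow> 2 \<le> card (N w)"
    and u: "u \<in> U" and ab: "N u = {a, b}" "a \<noteq> b"
    and v: "v \<in> N a" "v \<in> N b" "v \<noteq> u"
  shows "3 * card U - 2 \<le> card E"
proof -
  interpret F: K23_saturated_bipartite V U E by (rule flip)
  let ?W = "N a \<union> N b" and ?Y = "V - {a, b}"
  let ?R = "U - ?W"
  have V: "a \<in> V" "b \<in> V" using nbrs_subset[OF u] ab by auto
  have W: "?W \<subseteq> U" using F.nbrs_subset V by blast
  have card_Y: "card ?Y = card U - 2" using V ab card_eq finite_V by (simp add: card_Diff_subset)
  have card_U: "2 \<le> card U" using V ab card_eq finite_V two_le_card by metis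
  have "u \<in> N a" "u \<in> N b" using ab nbrs_sym[of u E a] nbrs_sym[of u E b] by simp_all
  then have common: "N a \<inter> N b = {u, v}"
    using v card_common_nbrs[OF ab(2)] finite_nbrs by (intro card_seteq[symmetric]) auto
  have in_W: "v \<in> N y \<or> 2 \<le> card (N y \<inter> ?W)" if "y \<in> ?Y" for y
    using new_copy_degree_2[OF u ab(1), of y] that common card_mono[of "N y \<inter> ?W" "N y \<inter> N a"]
      card_mono[of "N y \<inter> ?W" "N y \<inter> N b"] finite_nbrs by fastforce
  \<comment> \<open>Both \<open>a\<close> and \<open>b\<close> lie in \<open>N v\<close>, so a
    vertex outside \<open>N v\<close> is in \<open>?Y\<close> and \<open>in_W\<close> applies with
    its second alternative.\<close>
  have far: "N y \<inter> ?W \<noteq> {}" if "y \<in> V - N v" for y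
  proof -
    have "a \<in> N v" "b \<in> N v" "v \<notin> N y"
      using v that nbrs_sym[of v E a] nbrs_sym[of v E b] nbrs_sym[of v E y] by simp_all
    then show ?thesis using in_W[of y] that by fastforce
  qed
  have N_R: "N r \<subseteq> ?Y" if "r \<in> ?R" for r
    using that nbrs_subset[of r] nbrs_sym[of r E a] nbrs_sym[of r E b] by auto
  show ?thesis
  proof (cases "\<exists>r\<in>?R. (\<forall>y\<in>N r. N y \<inter> ?W = {v}) \<and> (\<exists>x\<in>N r. card (N x) = 2)")
    case True
    then obtain r x where "r \<in> ?R" "\<And>y. y \<in> N r \<Longrightarrow> N y \<inter> ?W = {v}" "x \<in> N r" "card (N x) = 2"
      by blast
    then show ?thesis using v by (intro card_edges_bad[OF deg _ W _ _ _ _ far]) auto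
  next
    case False
    \<comment> \<open>Discharging: \<open>y\<close> sends \<open>g y\<close> to each neighbour in \<open>?R\<close>. It can afford this out of twice its
      degree surplus over 2, and every vertex of \<open>?R\<close> receives at least 2.\<close>
    define g :: "'a \<Rightarrow> nat" where
      "g y = (if N y \<inter> ?W \<noteq> {v} then 2 else if card (N y) = 2 then 0 else 1)" for y
    have afford: "card (N y \<inter> ?R) * g y + 4 \<le> 2 * card (N y)" if y: "y \<in> ?Y" for y
    proof -
      have split: "card (N y) = card (N y \<inter> ?W) + card (N y \<inter> ?R)"
        using F.nbrs_subset[of y] y finite_nbrs
        by (subst card_Un_disjoint[symmetric]) (auto intro!: arg_cong[where f = card])
      have 2: "2 \<le> card (N y)" using deg y by simp
      show ?thesis
      proof (cases "N y \<inter> ?W = {v}")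
        case True
        then have "card (N y \<inter> ?W) = 1" by simp
        \<comment> \<open>Here \<open>N y\<close> has \<open>card (N y) - 1\<close> vertices in
          \<open>?R\<close>. For degree 2 nothing is sent; for degree d at least 3 the claim is (d -
          1) + 4 \<le> 2d.\<close>
        then show ?thesis using True split 2 by (auto simp: g_def)
      next
        case neq: False
        have "2 \<le> card (N y \<inter> ?W)"
        proof (cases "v \<in> N y")
          case True
          then obtain w where "w \<in> N y \<inter> ?W" "w \<noteq> v" using neq v by blast
          then show ?thesis using True v finite_nbrs by (intro two_le_card[of _ v w]) auto
        qed (use in_W[OF y] in blast)
        then show ?thesis using neq split by (simp add: g_def)
      qed
    qed
    have receive: "2 \<le> (\<Sum>y\<in>N r. g y)" if r: "r \<in> ?R" for r
    proof (cases "\<forall>y\<in>N r. N y \<inter> ?W = {v}")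
      case True
      \<comment> \<open>The outer case assumption excludes a neighbour of degree 2, so every
        neighbour of \<open>r\<close> sends 1.\<close>
      then have "card (N y) \<noteq> 2" if "y \<in> N r" for y using False r that by blast
      then have "g y = 1" if "y \<in> N r" for y using True that by (simp add: g_def)
      then have "(\<Sum>y\<in>N r. g y) = card (N r)" by simp
      then show ?thesis using deg r by simp
    next
      case False
      then obtain y where "y \<in> N r" "N y \<inter> ?W \<noteq> {v}" by blast
      moreover from this have "g y = 2" by (simp add: g_def)
      ultimately show ?thesis using member_le_sum[of y "N r" g] finite_nbrs by simp
    qed
    have "2 * card ?R \<le> (\<Sum>r\<in>?R. \<Sum>y\<in>N r. g y)"
      using sum_mono[of ?R "\<lambda>_. 2" "\<lambda>r. \<Sum>y\<in>N r. g y"] receive by simp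
    also have "\<dots> = (\<Sum>r\<in>?R. \<Sum>y\<in>{y\<in>?Y. r \<in> N y}. g y)"
    proof (intro sum.cong refl)
      fix r assume "r \<in> ?R"
      then have "y \<in> N r \<longleftrightarrow> y \<in> ?Y \<and> r \<in> N y" for y
        using N_R[of r] nbrs_sym[of r E y] by auto
      then show "N r = {y\<in>?Y. r \<in> N y}" by blast
    qed
    also have "\<dots> = (\<Sum>y\<in>?Y. \<Sum>r\<in>{r\<in>?R. r \<in> N y}. g y)"
      using finite_U finite_V by (intro sum.swap_restrict) auto
    also have "\<dots> = (\<Sum>y\<in>?Y. card (N y \<inter> ?R) * g y)"
    proof (intro sum.cong refl)
      fix y
      have "{r\<in>?R. r \<in> N y} = N y \<inter> ?R" by auto
      then show "(\<Sum>r\<in>{r\<in>?R. r \<in> N y}. g y) = card (N y \<inter> ?R) * g y" by simp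
    qed
    finally have "2 * card ?R + 4 * card ?Y \<le> (\<Sum>y\<in>?Y. card (N y \<inter> ?R) * g y + 4)"
      by (simp add: sum.distrib)
    also have "\<dots> \<le> 2 * (\<Sum>y\<in>?Y. card (N y))"
      unfolding sum_distrib_left by (rule sum_mono) (rule afford)
    finally have "card ?R + 2 * card ?Y \<le> (\<Sum>y\<in>?Y. card (N y))" by simp
    moreover have "card E = card ?W + 2 + (\<Sum>y\<in>?Y. card (N y))"
      using card_edges_pair[OF V ab(2)] common v(3) by simp
    moreover have "card ?R = card U - card ?W" using W finite_nbrs by (simp add: card_Diff_subset)
    moreover have "card ?W \<le> card U" using W finite_U by (rule card_mono[rotated])
    \<comment> \<open>\<open>card ?W\<close> and \<open>card ?R\<close> add up to n =
      \<open>card U\<close>, so the bound is n + 2 + 2(n - 2).\<close>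
    ultimately show ?thesis using card_Y card_U by linarith
  qed
qed

section \<open>Case distinction on the minimum degree\<close>

lemma card_edges_ge: "3 * card U - 2 \<le> card E"
proof -
  interpret F: K23_saturated_bipartite V U E by (rule flip)
  consider (low) w where "w \<in> U \<union> V" "card (N w) < 2"
    | (high) "\<And>w. w \<in> U \<Longrightarrow> 3 \<le> card (N w)"
    | (two) u where "\<And>w. w \<in> U \<union> V \<Longrightarrow> 2 \<le> card (N w)" "u \<in> U" "card (N u) = 2"
    by (metis Suc_1 UnI1 eval_nat_numeral(3) le_antisym not_less_eq_eq not_le)
  then show ?thesis
  proof cases
    case low
    then show ?thesis using card_edges_degree_1 F.card_edges_degree_1 card_eq by auto
  next
    case high
    then show ?thesis
      using sum_mono[of U "\<lambda>_. 3" "\<lambda>u. card (N u)"] by (simp add: card_edges)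
  next
    case two
    then obtain a b where ab: "N u = {a, b}" "a \<noteq> b" unfolding card_2_iff by blast
    have "u \<in> N a" "u \<in> N b" using ab nbrs_sym[of u E a] nbrs_sym[of u E b] by simp_all
    then consider "N a \<inter> N b = {u}" | v where "v \<in> N a" "v \<in> N b" "v \<noteq> u" by blast
    then show ?thesis
      using card_edges_degree_2_unique[OF two(1,2) ab] card_edges_degree_2_shared[OF two(1,2) ab]
      by cases
  qed
qed

end

theorem theorem4p1:
  fixes n :: nat and U U' :: "'a set" and E :: "'a set set"
  assumes "n \<ge> 4"
    and "bipartite_graph U U' E"
    and "card U = n" and "card U' = n"
    and "K23_saturated U U' E"
  shows "card E \<ge> 3 * n - 2"
proof -
  interpret K23_saturated_bipartite U U' E
    using assms by unfold_locales auto
  show ?thesis using card_edges_ge assms(3) by simp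
qed

end
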